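(* Let $\phi\bullet\psi$ be a product or skew-product dynamical system on $X\times Y$ with base system $\psi$ on $Y$, where $X,Y$ are compact metric spaces, and let $h\colon\mathsf{RC}(\phi\bullet\psi)\to\mathsf{RC}(\psi)$ be the order-preserving map dual to the lattice embedding $\iota_Y\colon\mathsf{Att}(\psi)\to\mathsf{Att}(\phi\bullet\psi)$, $\iota_Y(A)=\mathrm{Inv}(X\times A)$; explicitly, for $\xi\in\mathsf{RC}(\phi\bullet\psi)$, with $J_\xi=\{A\in\mathsf{Att}(\psi)\mid \xi\not\subset\iota_Y(A)\}$, $$h(\xi)=\Big(\bigcap_{A\in\mathsf{Att}(\psi)\setminus J_\xi}A\Big)\cap\Big(\bigcap_{A\in J_\xi}A^*\Big).$$ Then $\pi_Y(\xi)\subset h(\xi)$ for every $\xi\in\mathsf{RC}(\phi\bullet\psi)$, where $\pi_Y\colon X\times Y\to Y$ is the projection.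
   Context: $\mathbb{T}$ is $\mathbb{Z}$ or $\mathbb{R}$, $\mathbb{T}^+$ its nonnegative part. A dynamical system on a compact metric space $Z$ is a continuous map $\theta\colon\mathbb{T}^+\times Z\to Z$ with $\theta(0,z)=z$, $\theta(t,\theta(s,z))=\theta(t+s,z)$ (not assumed injective or surjective). Product system: for dynamical systems $\phi$ on $X$ and $\psi$ on $Y$, $(\phi\times\psi)(t,(x,y))=(\phi(t,x),\psi(t,y))$. Skew-product system: $(\phi\rtimes\psi)(t,(x,y))=(\phi(t,x,y),\psi(t,y))$ where $\psi$ is a dynamical system on $Y$ and $\phi\colon\mathbb{T}^+\times X\times Y\to X$ is continuous with $\phi(0,x,y)=x$ and the cocycle property $\phi(t+s,x,y)=\phi(t,\phi(s,x,y),\psi(s,y))$. $\phi\bullet\psi$ denotes either. A set $S$ is invariant if $\theta(t,S)=S$ for all $t\ge0$; $\mathrm{Inv}(U)$ is the union of all invariant subsets of $U$. $\omega(U)=\bigcap_{t\ge0}\mathrm{cl}(\theta([t,\infty),U))$, $\omega(z)=\omega(\{z\})$. $U$ is an attracting neighborhood if there is $\tau>0$ with $\theta(t,\mathrm{cl}(U))\subset\mathrm{int}(U)$ for all $t\ge\tau$; an attractor is $\omega(U)$ ($=\mathrm{Inv}(U)$) for an attracting neighborhood $U$. $\mathsf{Att}(\theta)$ is the bounded distributive lattice of attractors with $\vee=\cup$, $A\wedge B=\omega(A\cap B)$. The dual repeller of $A$ is $A^*=\{z\mid\omega(z)\cap A=\emptyset\}$. $\mathcal R(\theta)=\bigcap_{A\in\mathsf{Att}(\theta)}(A\cup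 A^* )$. $\mathsf{RC}(\theta)$ is the set of equivalence classes of $\mathcal R(\theta)$ under: $z\sim z'$ iff for every attractor $A$ either $z,z'\in A$ or $z,z'\in A^*$; it is ordered by $\xi\le\xi'$ iff every attractor containing $\xi'$ contains $\xi$. The spectrum $\Sigma L$ of a bounded distributive lattice $L$ is its ordered set of prime ideals; $\xi\mapsto I_\xi=\{A\mid\xi\not\subset A\}$ identifies $\mathsf{RC}(\theta)$ with $\Sigma\mathsf{Att}(\theta)$, with inverse $I\mapsto\big(\bigcap_{A\notin I}A\big)\cap\big(\bigcap_{A\in I}A^*\big)$. Under these identifications $h$ is the map $I\mapsto\iota_Y^{-1}(I)$ from $\Sigma\mathsf{Att}(\phi\bullet\psi)$ to $\Sigma\mathsf{Att}(\psi)$. *)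

theory Defs
  imports "HOL-Analysis.Analysis"
begin

text \<open>
  Both time domains are treated as subsets of the reals, so \<open>T\<close> below is always
  \<open>\<int>\<close> or \<open>UNIV\<close>; the values of a system at times outside \<open>nonneg T\<close> are irrelevant.
  A compact metric space is a type of class \<open>metric_space\<close> with compact \<open>UNIV\<close>, so that
  \<open>closure\<close>, \<open>interior\<close> and the empty intersection refer to the whole space.
\<close>

definition time_domain :: "real set \<Rightarrow> bool" where
  "time_domain T \<longleftrightarrow> T = \<int> \<or> T = UNIV"

definition nonneg :: "real set \<Rightarrow> real set" where
  "nonneg T = {t \<in> T. 0 \<le> t}"

definition dyn_sys :: "real set \<Rightarrow> (real \<Rightarrow> 'a::metric_space \<Rightarrow> 'a) \<Rightarrow> bool" where
  "dyn_sys T \<theta> \<longleftrightarrow>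
     continuous_on (nonneg T \<times> UNIV) (\<lambda>(t, z). \<theta> t z) \<and>
     (\<forall>z. \<theta> 0 z = z) \<and>
     (\<forall>t\<in>nonneg T. \<forall>s\<in>nonneg T. \<forall>z. \<theta> t (\<theta> s z) = \<theta> (t + s) z)"

definition cocycle_over ::
  "real set \<Rightarrow> (real \<Rightarrow> 'a::metric_space \<Rightarrow> 'b::metric_space \<Rightarrow> 'a) \<Rightarrow> (real \<Rightarrow> 'b \<Rightarrow> 'b) \<Rightarrow> bool" where
  "cocycle_over T \<phi> \<psi> \<longleftrightarrow>
     continuous_on (nonneg T \<times> UNIV \<times> UNIV) (\<lambda>(t, x, y). \<phi> t x y) \<and>
     (\<forall>x y. \<phi> 0 x y = x) \<and>
     (\<forall>t\<in>nonneg T. \<forall>s\<in>nonneg T. \<forall>x y. \<phi> (t + s) x y = \<phi> t (\<phi> s x y) (\<psi> s y))"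

definition product_sys ::
  "(real \<Rightarrow> 'a \<Rightarrow> 'a) \<Rightarrow> (real \<Rightarrow> 'b \<Rightarrow> 'b) \<Rightarrow> real \<Rightarrow> 'a \<times> 'b \<Rightarrow> 'a \<times> 'b" where
  "product_sys \<phi> \<psi> t = (\<lambda>(x, y). (\<phi> t x, \<psi> t y))"

definition skew_product_sys ::
  "(real \<Rightarrow> 'a \<Rightarrow> 'b \<Rightarrow> 'a) \<Rightarrow> (real \<Rightarrow> 'b \<Rightarrow> 'b) \<Rightarrow> real \<Rightarrow> 'a \<times> 'b \<Rightarrow> 'a \<times> 'b" where
  "skew_product_sys \<phi> \<psi> t = (\<lambda>(x, y). (\<phi> t x y, \<psi> t y))"

definition product_or_skew_product ::
  "real set \<Rightarrow> (real \<Rightarrow> 'b::metric_space \<Rightarrow> 'b) \<Rightarrow> (real \<Rightarrow> 'a::metric_space \<times> 'b \<Rightarrow> 'a \<times> 'b) \<Rightarrow> bool" where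
  "product_or_skew_product T \<psi> \<Theta> \<longleftrightarrow>
     dyn_sys T \<psi> \<and>
     ((\<exists>\<phi>. dyn_sys T \<phi> \<and> \<Theta> = product_sys \<phi> \<psi>) \<or>
      (\<exists>\<phi>. cocycle_over T \<phi> \<psi> \<and> \<Theta> = skew_product_sys \<phi> \<psi>))"

definition invariant :: "real set \<Rightarrow> (real \<Rightarrow> 'a \<Rightarrow> 'a) \<Rightarrow> 'a set \<Rightarrow> bool" where
  "invariant T \<theta> S \<longleftrightarrow> (\<forall>t\<in>nonneg T. \<theta> t ` S = S)"

definition Inv :: "real set \<Rightarrow> (real \<Rightarrow> 'a \<Rightarrow> 'a) \<Rightarrow> 'a set \<Rightarrow> 'a set" where
  "Inv T \<theta> U = \<Union>{S. invariant T \<theta> S \<and> S \<subseteq> U}"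

definition omega_limit :: "real set \<Rightarrow> (real \<Rightarrow> 'a::metric_space \<Rightarrow> 'a) \<Rightarrow> 'a set \<Rightarrow> 'a set" where
  "omega_limit T \<theta> U = (\<Inter>t\<in>nonneg T. closure (\<Union>s\<in>{s \<in> T. t \<le> s}. \<theta> s ` U))"

definition attracting_nbhd :: "real set \<Rightarrow> (real \<Rightarrow> 'a::metric_space \<Rightarrow> 'a) \<Rightarrow> 'a set \<Rightarrow> bool" where
  "attracting_nbhd T \<theta> U \<longleftrightarrow>
     (\<exists>\<tau>\<in>T. 0 < \<tau> \<and> (\<forall>t\<in>T. \<tau> \<le> t \<longrightarrow> \<theta> t ` closure U \<subseteq> interior U))"

definition Att :: "real set \<Rightarrow> (real \<Rightarrow> 'a::metric_space \<Rightarrow> 'a) \<Rightarrow> 'a set set" where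
  "Att T \<theta> = {omega_limit T \<theta> U | U. attracting_nbhd T \<theta> U}"

definition dual_repeller :: "real set \<Rightarrow> (real \<Rightarrow> 'a::metric_space \<Rightarrow> 'a) \<Rightarrow> 'a set \<Rightarrow> 'a set" where
  "dual_repeller T \<theta> A = {z. omega_limit T \<theta> {z} \<inter> A = {}}"

definition chain_recurrent_set :: "real set \<Rightarrow> (real \<Rightarrow> 'a::metric_space \<Rightarrow> 'a) \<Rightarrow> 'a set" where
  "chain_recurrent_set T \<theta> = (\<Inter>A\<in>Att T \<theta>. A \<union> dual_repeller T \<theta> A)"

definition RC_rel :: "real set \<Rightarrow> (real \<Rightarrow> 'a::metric_space \<Rightarrow> 'a) \<Rightarrow> ('a \<times> 'a) set" where
  "RC_rel T \<theta> = {(z, z'). z \<in> chain_recurrent_set T \<theta> \<and> z' \<in> chain_recurrent_set T \<theta> \<and>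
     (\<forall>A\<in>Att T \<theta>. (z \<in> A \<and> z' \<in> A) \<or> (z \<in> dual_repeller T \<theta> A \<and> z' \<in> dual_repeller T \<theta> A))}"

definition RC :: "real set \<Rightarrow> (real \<Rightarrow> 'a::metric_space \<Rightarrow> 'a) \<Rightarrow> 'a set set" where
  "RC T \<theta> = chain_recurrent_set T \<theta> // RC_rel T \<theta>"

text \<open>
  On prime ideals \<open>I\<close> of the lattice \<open>Att T \<theta>\<close>, this is the inverse of
  \<open>\<xi> \<mapsto> {A \<in> Att T \<theta>. \<not> \<xi> \<subseteq> A}\<close>.
\<close>

definition RC_of_ideal :: "real set \<Rightarrow> (real \<Rightarrow> 'a::metric_space \<Rightarrow> 'a) \<Rightarrow> 'a set set \<Rightarrow> 'a set" where
  "RC_of_ideal T \<theta> I = (\<Inter>A\<in>Att T \<theta> - I. A) \<inter> (\<Inter>A\<in>I. dual_repeller T \<theta> A)"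

definition iota_Y :: "real set \<Rightarrow> (real \<Rightarrow> 'a \<times> 'b \<Rightarrow> 'a \<times> 'b) \<Rightarrow> 'b set \<Rightarrow> ('a \<times> 'b) set" where
  "iota_Y T \<Theta> A = Inv T \<Theta> (UNIV \<times> A)"

text \<open>
  The preimage under \<open>iota_Y\<close> of the prime ideal of attractors of \<open>\<Theta>\<close> not containing \<open>\<xi>\<close>.
\<close>

definition pulled_back_ideal ::
  "real set \<Rightarrow> (real \<Rightarrow> 'b::metric_space \<Rightarrow> 'b) \<Rightarrow> (real \<Rightarrow> 'a::metric_space \<times> 'b \<Rightarrow> 'a \<times> 'b) \<Rightarrow>
     ('a \<times> 'b) set \<Rightarrow> 'b set set" where
  "pulled_back_ideal T \<psi> \<Theta> \<xi> = {A \<in> Att T \<psi>. \<not> \<xi> \<subseteq> iota_Y T \<Theta> A}"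

definition h_dual ::
  "real set \<Rightarrow> (real \<Rightarrow> 'b::metric_space \<Rightarrow> 'b) \<Rightarrow> (real \<Rightarrow> 'a::metric_space \<times> 'b \<Rightarrow> 'a \<times> 'b) \<Rightarrow>
     ('a \<times> 'b) set \<Rightarrow> 'b set" where
  "h_dual T \<psi> \<Theta> \<xi> = RC_of_ideal T \<psi> (pulled_back_ideal T \<psi> \<Theta> \<xi>)"

end

theory Submission
  imports Defs
begin

text \<open>
  The points of a class \<open>\<xi>\<close> share one alternative for each attractor \<open>A\<close> of the base: either
  \<open>\<xi>\<close> lies in \<open>Inv (X \<times> A)\<close>, or \<open>\<xi>\<close> lies in its dual repeller. Since \<open>Inv (X \<times> A)\<close>
  lies over \<open>A\<close>, the first alternative projects to \<open>A\<close>. The theorem therefore says that the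
  second one projects to the dual repeller of \<open>A\<close>
  (\<open>snd_dual_repeller_iota_Y\<close>).

  Suppose that \<open>z\<close> lies over \<open>y\<close> and that \<open>\<omega>(y)\<close> meets \<open>A\<close>. As \<open>A\<close> is an
  attractor, an orbit that accumulates on it is captured by it, so \<open>\<omega>(y) \<subseteq> A\<close>
  (\<open>omega_limit_subset_attractor\<close>). Now \<open>\<omega>(z)\<close> lies over \<open>\<omega>(y)\<close>, hence in
  \<open>X \<times> A\<close>; by compactness it is nonempty and invariant, hence contained in \<open>Inv (X \<times> A)\<close>.
  So \<open>z\<close> is not in the dual repeller of \<open>Inv (X \<times> A)\<close>.

  The dichotomy for \<open>\<xi>\<close> requires that \<open>Inv (X \<times> A)\<close> be an attractor. If \<open>U\<close> is an
  attracting neighborhood of \<open>A\<close>, then \<open>X \<times> U\<close> is attracting and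
  \<open>\<omega>(X \<times> U) = Inv (X \<times> A)\<close> (\<open>iota_Y_omega_limit\<close>).
  Apart from its continuity and the semigroup law, these arguments use only that the system
  projects to \<open>\<psi>\<close>, so products and skew products are treated together.
\<close>

section \<open>Limit sets in compact spaces\<close>

definition orbit_tail :: "real set \<Rightarrow> (real \<Rightarrow> 'a \<Rightarrow> 'a) \<Rightarrow> real \<Rightarrow> 'a set \<Rightarrow> 'a set" where
  "orbit_tail T \<theta> t U = (\<Union>s\<in>{s \<in> T. t \<le> s}. \<theta> s ` U)"

lemma omega_limit_eq: "omega_limit T \<theta> U = (\<Inter>t\<in>nonneg T. closure (orbit_tail T \<theta> t U))"
  by (simp add: omega_limit_def orbit_tail_def)

lemma orbit_tail_antimono: "s \<le> t \<Longrightarrow> orbit_tail T \<theta> t U \<subseteq> orbit_tail T \<theta> s U"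
  unfolding orbit_tail_def by force

lemma orbit_tail_mono: "U \<subseteq> V \<Longrightarrow> orbit_tail T \<theta> t U \<subseteq> orbit_tail T \<theta> t V"
  unfolding orbit_tail_def by blast

lemma omega_limit_mono: "U \<subseteq> V \<Longrightarrow> omega_limit T \<theta> U \<subseteq> omega_limit T \<theta> V"
  unfolding omega_limit_eq by (intro INF_mono' closure_mono orbit_tail_mono)

lemma closed_omega_limit: "closed (omega_limit T \<theta> U)"
  unfolding omega_limit_eq by auto

lemma time_domain_add: "time_domain T \<Longrightarrow> s \<in> T \<Longrightarrow> t \<in> T \<Longrightarrow> s + t \<in> T"
  by (auto simp: time_domain_def)

lemma time_domain_diff: "time_domain T \<Longrightarrow> s \<in> T \<Longrightarrow> t \<in> T \<Longrightarrow> s - t \<in> T"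
  by (auto simp: time_domain_def)

lemma nonneg_zero: "time_domain T \<Longrightarrow> 0 \<in> nonneg T"
  by (auto simp: time_domain_def nonneg_def)

lemma nonneg_add: "time_domain T \<Longrightarrow> s \<in> nonneg T \<Longrightarrow> t \<in> nonneg T \<Longrightarrow> s + t \<in> nonneg T"
  by (auto simp: nonneg_def time_domain_add)

lemma dyn_sys_continuous:
  assumes "dyn_sys T \<theta>" "t \<in> nonneg T"
  shows "continuous_on UNIV (\<theta> t)"
proof -
  have "continuous_on UNIV (\<lambda>z. (\<lambda>(t, z). \<theta> t z) (t, z))"
    by (rule continuous_on_compose2[where t = "nonneg T \<times> UNIV"])
      (use assms in \<open>auto simp: dyn_sys_def intro: continuous_on_Pair\<close>)
  then show ?thesis by simp
qed

lemma image_orbit_tail: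
  assumes "time_domain T" "dyn_sys T \<theta>" "t \<in> nonneg T" "r \<in> nonneg T"
  shows "\<theta> t ` orbit_tail T \<theta> r U = orbit_tail T \<theta> (r + t) U"
proof (intro subset_antisym subsetI)
  fix w assume "w \<in> \<theta> t ` orbit_tail T \<theta> r U"
  then obtain s u where "s \<in> T" "r \<le> s" "u \<in> U" "w = \<theta> t (\<theta> s u)"
    by (auto simp: orbit_tail_def)
  then have "w = \<theta> (s + t) u" "s + t \<in> T" "r + t \<le> s + t"
    using assms by (auto simp: dyn_sys_def nonneg_def time_domain_add add.commute)
  then show "w \<in> orbit_tail T \<theta> (r + t) U"
    using \<open>u \<in> U\<close> by (auto simp: orbit_tail_def)
next
  fix w assume "w \<in> orbit_tail T \<theta> (r + t) U"
  then obtain s u where s: "s \<in> T" "r + t \<le> s" "u \<in> U" "w = \<theta> s u"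
    by (auto simp: orbit_tail_def)
  then have "s - t \<in> nonneg T"
    using assms by (auto simp: nonneg_def time_domain_diff)
  then have "\<theta> t (\<theta> (s - t) u) = \<theta> (t + (s - t)) u"
    using assms by (auto simp: dyn_sys_def)
  then have "w = \<theta> t (\<theta> (s - t) u)"
    using s by simp
  moreover have "\<theta> (s - t) u \<in> orbit_tail T \<theta> r U"
    using s \<open>s - t \<in> nonneg T\<close> by (force simp: orbit_tail_def nonneg_def)
  ultimately show "w \<in> \<theta> t ` orbit_tail T \<theta> r U" by blast
qed

lemma compact_decreasing_INT_nonempty:
  fixes F :: "real \<Rightarrow> 'a::metric_space set"
  assumes "compact (UNIV :: 'a set)" "R \<noteq> {}"
    and "\<And>r. r \<in> R \<Longrightarrow> closed (F r)" "\<And>r. r \<in> R \<Longrightarrow> F r \<noteq> {}"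
    and "\<And>r s. r \<in> R \<Longrightarrow> s \<in> R \<Longrightarrow> r \<le> s \<Longrightarrow> F s \<subseteq> F r"
  shows "(\<Inter>r\<in>R. F r) \<noteq> {}"
proof -
  have "UNIV \<inter> (\<Inter>r\<in>R. F r) \<noteq> {}"
  proof (rule compact_imp_fip_image[OF assms(1)])
    fix R' assume R': "finite R'" "R' \<subseteq> R"
    show "UNIV \<inter> (\<Inter>r\<in>R'. F r) \<noteq> {}"
    proof (cases "R' = {}")
      case False
      then have Max: "Max R' \<in> R"
        using R' Max_in by blast
      then have "F (Max R') \<subseteq> F r" if "r \<in> R'" for r
        using that R' by (intro assms(5)) auto
      then have "F (Max R') \<subseteq> UNIV \<inter> (\<Inter>r\<in>R'. F r)" by blast
      then show ?thesis using assms(4)[OF Max] by blast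
    qed auto
  qed (use assms(3) in auto)
  then show ?thesis by simp
qed

lemma omega_limit_nonempty:
  fixes \<theta> :: "real \<Rightarrow> 'a::metric_space \<Rightarrow> 'a"
  assumes "time_domain T" "compact (UNIV :: 'a set)" "U \<noteq> {}"
  shows "omega_limit T \<theta> U \<noteq> {}"
  unfolding omega_limit_eq
proof (rule compact_decreasing_INT_nonempty[OF assms(2)])
  show "nonneg T \<noteq> {}" using nonneg_zero[OF assms(1)] by auto
  fix r assume "r \<in> nonneg T"
  then have "orbit_tail T \<theta> r U \<noteq> {}"
    using assms(3) by (auto simp: orbit_tail_def nonneg_def)
  then show "closure (orbit_tail T \<theta> r U) \<noteq> {}" by simp
qed (auto intro!: closure_mono orbit_tail_antimono del: subsetI)

text \<open>
  The time-\<open>t\<close> map sends the tail from \<open>r\<close> onto the tail from \<open>r + t\<close>, and by compactness it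
  sends the closure of the one onto the closure of the other. Hence each \<open>w\<close> in the limit set has
  a preimage in the closure of every tail; these preimages form a decreasing family of nonempty
  compact sets, and a common point of them is a preimage of \<open>w\<close> in the limit set.
\<close>

lemma invariant_omega_limit:
  fixes \<theta> :: "real \<Rightarrow> 'a::metric_space \<Rightarrow> 'a"
  assumes T: "time_domain T" and comp: "compact (UNIV :: 'a set)" and dyn: "dyn_sys T \<theta>"
  shows "invariant T \<theta> (omega_limit T \<theta> U)"
  unfolding invariant_def
proof (intro ballI subset_antisym)
  fix t assume t: "t \<in> nonneg T"
  let ?F = "\<lambda>r. closure (orbit_tail T \<theta> r U)"
  have cont: "continuous_on S (\<theta> t)" for S
    using dyn_sys_continuous[OF dyn t] continuous_on_subset by blast
  have image_closure: "\<theta> t ` ?F r = ?F (r + t)" if "r \<in> nonneg T" for r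
  proof -
    have "compact (?F r)"
      using compact_Int_closed[OF comp closed_closure] by simp
    then have "closed (\<theta> t ` ?F r)"
      by (intro compact_imp_closed compact_continuous_image cont)
    then have "closure (\<theta> t ` orbit_tail T \<theta> r U) \<subseteq> \<theta> t ` ?F r"
      by (intro closure_minimal image_mono closure_subset)
    moreover have "\<theta> t ` ?F r \<subseteq> closure (\<theta> t ` orbit_tail T \<theta> r U)"
      by (intro image_closure_subset cont closed_closure closure_subset)
    ultimately have "\<theta> t ` ?F r = closure (\<theta> t ` orbit_tail T \<theta> r U)"
      by (rule subset_antisym[rotated])
    then show ?thesis using image_orbit_tail[OF T dyn t that] by simp
  qed
  show "\<theta> t ` omega_limit T \<theta> U \<subseteq> omega_limit T \<theta> U"
  proof
    fix w assume w: "w \<in> \<theta> t ` omega_limit T \<theta> U"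
    have "w \<in> ?F r" if r: "r \<in> nonneg T" for r
    proof -
      have "w \<in> ?F (r + t)"
        using w r image_closure[OF r] by (auto simp: omega_limit_eq)
      then show ?thesis
        using closure_mono[OF orbit_tail_antimono[of r "r + t" T \<theta> U]] t
        by (auto simp: nonneg_def)
    qed
    then show "w \<in> omega_limit T \<theta> U" by (simp add: omega_limit_eq)
  qed
  show "omega_limit T \<theta> U \<subseteq> \<theta> t ` omega_limit T \<theta> U"
  proof
    fix w assume w: "w \<in> omega_limit T \<theta> U"
    have "(\<Inter>r\<in>nonneg T. ?F r \<inter> \<theta> t -` {w}) \<noteq> {}"
    proof (rule compact_decreasing_INT_nonempty[OF comp])
      show "nonneg T \<noteq> {}" using t by blast
      fix r assume r: "r \<in> nonneg T"
      show "closed (?F r \<inter> \<theta> t -` {w})"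
        by (intro closed_Int closed_closure closed_vimage closed_singleton cont)
      have "w \<in> ?F (r + t)"
        using w nonneg_add[OF T r t] by (auto simp: omega_limit_eq)
      then have "w \<in> \<theta> t ` ?F r"
        by (simp only: image_closure[OF r])
      then show "?F r \<inter> \<theta> t -` {w} \<noteq> {}" by blast
    next
      fix r s :: real assume "r \<le> s"
      then show "?F s \<inter> \<theta> t -` {w} \<subseteq> ?F r \<inter> \<theta> t -` {w}"
        by (intro Int_mono closure_mono orbit_tail_antimono order_refl)
    qed
    then obtain v where "\<And>r. r \<in> nonneg T \<Longrightarrow> v \<in> ?F r \<and> \<theta> t v = w"
      by blast
    then have "v \<in> omega_limit T \<theta> U" "w = \<theta> t v"
      using t by (auto simp: omega_limit_eq)
    then show "w \<in> \<theta> t ` omega_limit T \<theta> U"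
      by (simp only: imageI)
  qed
qed

lemma invariant_subset_omega_limit:
  assumes "invariant T \<theta> S" "S \<subseteq> U"
  shows "S \<subseteq> omega_limit T \<theta> U"
proof -
  have "S \<subseteq> orbit_tail T \<theta> t S" if t: "t \<in> nonneg T" for t
    using assms(1) t by (force simp: invariant_def orbit_tail_def nonneg_def)
  then have "S \<subseteq> omega_limit T \<theta> S"
    unfolding omega_limit_eq using closure_subset by blast
  then show ?thesis using omega_limit_mono[OF assms(2)] by blast
qed

lemma omega_limit_subset_invariant:
  assumes "time_domain T" "invariant T \<theta> S" "closed S" "U \<subseteq> S"
  shows "omega_limit T \<theta> U \<subseteq> S"
proof -
  have "orbit_tail T \<theta> 0 U \<subseteq> S"
    using assms(2,4) by (auto simp: orbit_tail_def invariant_def nonneg_def)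
  then have "closure (orbit_tail T \<theta> 0 U) \<subseteq> S"
    using assms(3) by (rule closure_minimal)
  then show ?thesis
    using nonneg_zero[OF assms(1)] by (auto simp: omega_limit_eq)
qed

lemma omega_limit_semiconjugacy:
  assumes p: "continuous_on UNIV p"
    and semiconj: "\<And>t z. t \<in> nonneg T \<Longrightarrow> p (\<theta> t z) = \<psi> t (p z)"
  shows "p ` omega_limit T \<theta> U \<subseteq> omega_limit T \<psi> (p ` U)"
proof -
  have "p ` omega_limit T \<theta> U \<subseteq> closure (orbit_tail T \<psi> t (p ` U))" if t: "t \<in> nonneg T" for t
  proof -
    have "p ` orbit_tail T \<theta> t U \<subseteq> orbit_tail T \<psi> t (p ` U)"
      using t by (auto simp: orbit_tail_def nonneg_def semiconj)
    then have "p ` closure (orbit_tail T \<theta> t U) \<subseteq> closure (orbit_tail T \<psi> t (p ` U))"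
      by (intro image_closure_subset continuous_on_subset[OF p])
        (use closure_subset in blast)+
    then show ?thesis using t by (auto simp: omega_limit_eq)
  qed
  then show ?thesis unfolding omega_limit_eq[of T \<psi>] by blast
qed

section \<open>Attractors\<close>

text \<open>
  From the absorption time on, the orbits of \<open>U\<close> stay in \<open>U\<close>, so the limit set lies in the closure
  of \<open>U\<close>. Being invariant, it is its own image at the absorption time and thus lies in the interior.
\<close>

lemma omega_limit_subset_interior:
  fixes \<theta> :: "real \<Rightarrow> 'a::metric_space \<Rightarrow> 'a"
  assumes "time_domain T" "compact (UNIV :: 'a set)" "dyn_sys T \<theta>" "attracting_nbhd T \<theta> U"
  shows "omega_limit T \<theta> U \<subseteq> interior U"
proof -
  obtain \<tau> where \<tau>: "\<tau> \<in> T" "0 < \<tau>"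
    and absorb: "\<And>t. t \<in> T \<Longrightarrow> \<tau> \<le> t \<Longrightarrow> \<theta> t ` closure U \<subseteq> interior U"
    using assms(4) by (auto simp: attracting_nbhd_def)
  have "\<tau> \<in> nonneg T" using \<tau> by (simp add: nonneg_def)
  have "orbit_tail T \<theta> \<tau> U \<subseteq> U"
    using absorb closure_subset[of U] interior_subset[of U] by (fastforce simp: orbit_tail_def)
  then have "closure (orbit_tail T \<theta> \<tau> U) \<subseteq> closure U"
    by (rule closure_mono)
  then have "omega_limit T \<theta> U \<subseteq> closure U"
    using \<open>\<tau> \<in> nonneg T\<close> unfolding omega_limit_eq by blast
  then have "\<theta> \<tau> ` omega_limit T \<theta> U \<subseteq> interior U"
    using absorb[OF \<tau>(1) order_refl] by blast
  moreover have "\<theta> \<tau> ` omega_limit T \<theta> U = omega_limit T \<theta> U"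
    using invariant_omega_limit[OF assms(1-3)] \<open>\<tau> \<in> nonneg T\<close> by (simp add: invariant_def)
  ultimately show ?thesis by simp
qed

text \<open>
  An orbit that accumulates on the attractor enters the neighborhood \<open>U\<close> at some time \<open>s\<close>; from
  then on it is, up to the shift by \<open>s\<close>, an orbit starting in \<open>U\<close>.
\<close>

lemma omega_limit_subset_attractor:
  fixes \<theta> :: "real \<Rightarrow> 'a::metric_space \<Rightarrow> 'a"
  assumes T: "time_domain T" and "compact (UNIV :: 'a set)" and dyn: "dyn_sys T \<theta>"
    and "A \<in> Att T \<theta>" and meets: "omega_limit T \<theta> {z} \<inter> A \<noteq> {}"
  shows "omega_limit T \<theta> {z} \<subseteq> A"
proof -
  obtain U where A: "A = omega_limit T \<theta> U" and U: "attracting_nbhd T \<theta> U"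
    using assms(4) by (auto simp: Att_def)
  have "A \<subseteq> interior U"
    using omega_limit_subset_interior[OF assms(1-3) U] A by simp
  then have "interior U \<inter> closure (orbit_tail T \<theta> 0 {z}) \<noteq> {}"
    using meets nonneg_zero[OF T] by (auto simp: omega_limit_eq)
  then have "interior U \<inter> orbit_tail T \<theta> 0 {z} \<noteq> {}"
    by (simp add: open_Int_closure_eq_empty)
  then obtain s where s: "s \<in> nonneg T" "\<theta> s z \<in> U"
    using interior_subset by (auto simp: orbit_tail_def nonneg_def)
  have "orbit_tail T \<theta> (t + s) {z} \<subseteq> orbit_tail T \<theta> t U" if t: "t \<in> nonneg T" for t
  proof
    fix w assume "w \<in> orbit_tail T \<theta> (t + s) {z}"
    then obtain r where r: "r \<in> T" "t + s \<le> r" "w = \<theta> r z"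
      by (auto simp: orbit_tail_def)
    then have rs: "r - s \<in> nonneg T" "t \<le> r - s"
      using s t T by (auto simp: nonneg_def time_domain_diff)
    then have "\<theta> (r - s) (\<theta> s z) = \<theta> ((r - s) + s) z"
      using dyn s by (auto simp: dyn_sys_def)
    then have "w = \<theta> (r - s) (\<theta> s z)"
      using r by simp
    then show "w \<in> orbit_tail T \<theta> t U"
      using rs s by (auto simp: orbit_tail_def nonneg_def)
  qed
  then have "omega_limit T \<theta> {z} \<subseteq> closure (orbit_tail T \<theta> t U)" if "t \<in> nonneg T" for t
    unfolding omega_limit_eq using that nonneg_add[OF T that s(1)]
    by (intro INF_lower2[where i = "t + s"] closure_mono)
  then show ?thesis
    unfolding A omega_limit_eq[of T \<theta> U] by (rule INF_greatest)
qed

lemma invariant_attractor: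
  fixes \<theta> :: "real \<Rightarrow> 'a::metric_space \<Rightarrow> 'a"
  assumes "time_domain T" "compact (UNIV :: 'a set)" "dyn_sys T \<theta>" "A \<in> Att T \<theta>"
  shows "invariant T \<theta> A"
  using assms(4) invariant_omega_limit[OF assms(1-3)] by (auto simp: Att_def)

lemma attractor_Int_dual_repeller:
  fixes \<theta> :: "real \<Rightarrow> 'a::metric_space \<Rightarrow> 'a"
  assumes "time_domain T" "compact (UNIV :: 'a set)" "dyn_sys T \<theta>" "A \<in> Att T \<theta>"
  shows "A \<inter> dual_repeller T \<theta> A = {}"
proof -
  have "omega_limit T \<theta> {z} \<inter> A \<noteq> {}" if "z \<in> A" for z
  proof -
    have "closed A" using assms(4) closed_omega_limit by (auto simp: Att_def)
    then have "omega_limit T \<theta> {z} \<subseteq> A"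
      using omega_limit_subset_invariant[OF assms(1) invariant_attractor[OF assms]] that by simp
    then show ?thesis
      using omega_limit_nonempty[OF assms(1,2), of "{z}" \<theta>] by auto
  qed
  then show ?thesis by (auto simp: dual_repeller_def)
qed

lemma RC_dichotomy:
  fixes \<theta> :: "real \<Rightarrow> 'a::metric_space \<Rightarrow> 'a"
  assumes "time_domain T" "compact (UNIV :: 'a set)" "dyn_sys T \<theta>"
    and "A \<in> Att T \<theta>" "\<xi> \<in> RC T \<theta>"
  shows "\<xi> \<subseteq> A \<or> \<xi> \<subseteq> dual_repeller T \<theta> A"
proof -
  obtain z0 where "\<xi> = RC_rel T \<theta> `` {z0}"
    using assms(5) by (auto simp: RC_def elim: quotientE)
  then have "(z0 \<in> A \<and> z \<in> A) \<or> (z0 \<in> dual_repeller T \<theta> A \<and> z \<in> dual_repeller T \<theta> A)"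
    if "z \<in> \<xi>" for z
    using that assms(4) by (auto simp: RC_rel_def)
  then show ?thesis
    using attractor_Int_dual_repeller[OF assms(1-4)] by blast
qed

section \<open>Systems over a base\<close>

lemma dyn_sys_product_or_skew_product:
  assumes "time_domain T" "product_or_skew_product T \<psi> \<Theta>"
  shows "dyn_sys T \<Theta>"
proof -
  have \<psi>: "dyn_sys T \<psi>" and cases:
    "(\<exists>\<phi>. dyn_sys T \<phi> \<and> \<Theta> = product_sys \<phi> \<psi>) \<or>
      (\<exists>\<phi>. cocycle_over T \<phi> \<psi> \<and> \<Theta> = skew_product_sys \<phi> \<psi>)"
    using assms(2) by (auto simp: product_or_skew_product_def)
  \<comment> \<open>A product system is the skew product whose cocycle ignores the base point.\<close>
  obtain \<phi> where \<phi>: "cocycle_over T \<phi> \<psi>" and \<Theta>: "\<Theta> = skew_product_sys \<phi> \<psi>"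
  proof -
    consider \<phi> where "dyn_sys T \<phi>" "\<Theta> = product_sys \<phi> \<psi>"
      | \<phi> where "cocycle_over T \<phi> \<psi>" "\<Theta> = skew_product_sys \<phi> \<psi>"
      using cases by blast
    then show thesis
    proof cases
      case (1 \<phi>)
      have "continuous_on (nonneg T \<times> UNIV \<times> UNIV) (\<lambda>q. (\<lambda>(t, x). \<phi> t x) (fst q, fst (snd q)))"
        by (rule continuous_on_compose2[where t = "nonneg T \<times> UNIV"])
          (use 1(1) in \<open>auto simp: dyn_sys_def intro!: continuous_intros\<close>)
      then have "cocycle_over T (\<lambda>t x y. \<phi> t x) \<psi>"
        using 1(1) by (auto simp: cocycle_over_def dyn_sys_def case_prod_unfold)
      moreover have "\<Theta> = skew_product_sys (\<lambda>t x y. \<phi> t x) \<psi>"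
        using 1(2) by (simp add: product_sys_def skew_product_sys_def fun_eq_iff)
      ultimately show ?thesis by (rule that)
    qed (rule that)
  qed
  have "continuous_on (nonneg T \<times> UNIV)
      (\<lambda>q. (\<lambda>(t, x, y). \<phi> t x y) (fst q, fst (snd q), snd (snd q)))"
    by (rule continuous_on_compose2[where t = "nonneg T \<times> UNIV \<times> UNIV"])
      (use \<phi> in \<open>auto simp: cocycle_over_def intro!: continuous_intros\<close>)
  moreover have "continuous_on (nonneg T \<times> UNIV) (\<lambda>q. (\<lambda>(t, y). \<psi> t y) (fst q, snd (snd q)))"
    by (rule continuous_on_compose2[where t = "nonneg T \<times> UNIV"])
      (use \<psi> in \<open>auto simp: dyn_sys_def intro!: continuous_intros\<close>)
  ultimately have "continuous_on (nonneg T \<times> UNIV) (\<lambda>(t, z). \<Theta> t z)"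
    unfolding \<Theta> skew_product_sys_def case_prod_unfold
    by (auto intro: continuous_on_Pair)
  then show ?thesis
    using \<phi> \<psi> by (auto simp: dyn_sys_def cocycle_over_def \<Theta> skew_product_sys_def)
qed

lemma snd_product_or_skew_product:
  "product_or_skew_product T \<psi> \<Theta> \<Longrightarrow> snd (\<Theta> t z) = \<psi> t (snd z)"
  by (auto simp: product_or_skew_product_def product_sys_def skew_product_sys_def case_prod_unfold)

lemma snd_omega_limit:
  assumes "product_or_skew_product T \<psi> \<Theta>"
  shows "snd ` omega_limit T \<Theta> U \<subseteq> omega_limit T \<psi> (snd ` U)"
  using assms
  by (intro omega_limit_semiconjugacy) (auto simp: snd_product_or_skew_product intro: continuous_intros)

lemma attracting_nbhd_UNIV_Times:
  assumes "product_or_skew_product T \<psi> \<Theta>" "attracting_nbhd T \<psi> U"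
  shows "attracting_nbhd T \<Theta> (UNIV \<times> U)"
proof -
  have "\<Theta> t z \<in> interior (UNIV \<times> U)"
    if "\<psi> t ` closure U \<subseteq> interior U" "z \<in> closure (UNIV \<times> U)" for t z
    using that snd_product_or_skew_product[OF assms(1), of t z]
    by (simp add: closure_Times interior_Times mem_Times_iff image_subset_iff)
  then show ?thesis using assms(2) unfolding attracting_nbhd_def by blast
qed

text \<open>
  The limit set of \<open>X \<times> U\<close> is invariant and lies over \<open>\<omega>(U)\<close>. Conversely,
  \<open>\<omega>(U) \<subseteq> U\<close>, so every invariant set over \<open>\<omega>(U)\<close> is contained in \<open>X \<times> U\<close>
  and hence in its limit set.
\<close>

lemma iota_Y_omega_limit:
  fixes \<psi> :: "real \<Rightarrow> 'b::metric_space \<Rightarrow> 'b"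
    and \<Theta> :: "real \<Rightarrow> 'a::metric_space \<times> 'b \<Rightarrow> 'a \<times> 'b"
  assumes T: "time_domain T" and X: "compact (UNIV :: 'a set)" and Y: "compact (UNIV :: 'b set)"
    and \<Theta>: "product_or_skew_product T \<psi> \<Theta>" and U: "attracting_nbhd T \<psi> U"
  shows "iota_Y T \<Theta> (omega_limit T \<psi> U) = omega_limit T \<Theta> (UNIV \<times> U)"
proof (intro subset_antisym)
  have \<psi>: "dyn_sys T \<psi>" using \<Theta> by (simp add: product_or_skew_product_def)
  have "omega_limit T \<psi> U \<subseteq> U"
    using omega_limit_subset_interior[OF T Y \<psi> U] interior_subset by blast
  then have "S \<subseteq> omega_limit T \<Theta> (UNIV \<times> U)"
    if "invariant T \<Theta> S" "S \<subseteq> UNIV \<times> omega_limit T \<psi> U" for S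
    by (intro invariant_subset_omega_limit that(1)) (use that(2) in blast)
  then show "iota_Y T \<Theta> (omega_limit T \<psi> U) \<subseteq> omega_limit T \<Theta> (UNIV \<times> U)"
    by (auto simp: iota_Y_def Inv_def)
  have "compact (UNIV :: ('a \<times> 'b) set)"
    using compact_Times[OF X Y] by simp
  then have "invariant T \<Theta> (omega_limit T \<Theta> (UNIV \<times> U))"
    using invariant_omega_limit T dyn_sys_product_or_skew_product[OF T \<Theta>] by blast
  moreover have "omega_limit T \<Theta> (UNIV \<times> U) \<subseteq> UNIV \<times> omega_limit T \<psi> U"
    using snd_omega_limit[OF \<Theta>, of "UNIV \<times> U"] by (auto simp: mem_Times_iff)
  ultimately show "omega_limit T \<Theta> (UNIV \<times> U) \<subseteq> iota_Y T \<Theta> (omega_limit T \<psi> U)"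
    by (auto simp: iota_Y_def Inv_def)
qed

lemma iota_Y_in_Att:
  fixes \<psi> :: "real \<Rightarrow> 'b::metric_space \<Rightarrow> 'b"
    and \<Theta> :: "real \<Rightarrow> 'a::metric_space \<times> 'b \<Rightarrow> 'a \<times> 'b"
  assumes "time_domain T" "compact (UNIV :: 'a set)" "compact (UNIV :: 'b set)"
    and "product_or_skew_product T \<psi> \<Theta>" "A \<in> Att T \<psi>"
  shows "iota_Y T \<Theta> A \<in> Att T \<Theta>"
  using assms(5) iota_Y_omega_limit[OF assms(1-4)] attracting_nbhd_UNIV_Times[OF assms(4)]
  by (auto simp: Att_def)

text \<open>
  If \<open>\<omega>(y)\<close> met \<open>A\<close>, it would lie in \<open>A\<close>, and the limit set of any point over \<open>y\<close> would be a
  nonempty invariant set over \<open>A\<close>, hence a nonempty part of \<open>Inv (X \<times> A)\<close>.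
\<close>

lemma snd_dual_repeller_iota_Y:
  fixes \<psi> :: "real \<Rightarrow> 'b::metric_space \<Rightarrow> 'b"
    and \<Theta> :: "real \<Rightarrow> 'a::metric_space \<times> 'b \<Rightarrow> 'a \<times> 'b"
  assumes T: "time_domain T" and X: "compact (UNIV :: 'a set)" and Y: "compact (UNIV :: 'b set)"
    and \<Theta>: "product_or_skew_product T \<psi> \<Theta>" and A: "A \<in> Att T \<psi>"
  shows "snd ` dual_repeller T \<Theta> (iota_Y T \<Theta> A) \<subseteq> dual_repeller T \<psi> A"
proof (intro image_subsetI, rule ccontr)
  fix z assume z: "z \<in> dual_repeller T \<Theta> (iota_Y T \<Theta> A)" and "snd z \<notin> dual_repeller T \<psi> A"
  then have "omega_limit T \<psi> {snd z} \<inter> A \<noteq> {}"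
    by (simp add: dual_repeller_def)
  moreover have "dyn_sys T \<psi>" using \<Theta> by (simp add: product_or_skew_product_def)
  ultimately have "omega_limit T \<psi> {snd z} \<subseteq> A"
    using omega_limit_subset_attractor[OF T Y _ A] by blast
  then have "omega_limit T \<Theta> {z} \<subseteq> UNIV \<times> A"
    using snd_omega_limit[OF \<Theta>, of "{z}"] by force
  moreover have XY: "compact (UNIV :: ('a \<times> 'b) set)"
    using compact_Times[OF X Y] by simp
  moreover have "invariant T \<Theta> (omega_limit T \<Theta> {z})"
    by (rule invariant_omega_limit[OF T XY dyn_sys_product_or_skew_product[OF T \<Theta>]])
  ultimately have "omega_limit T \<Theta> {z} \<subseteq> iota_Y T \<Theta> A"
    by (auto simp: iota_Y_def Inv_def)
  then have "omega_limit T \<Theta> {z} = {}"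
    using z by (auto simp: dual_repeller_def)
  then show False
    using omega_limit_nonempty[OF T XY, of "{z}" \<Theta>] by simp
qed

theorem theorem3p11:
  fixes T :: "real set"
    and \<psi> :: "real \<Rightarrow> 'b::metric_space \<Rightarrow> 'b"
    and \<Theta> :: "real \<Rightarrow> 'a::metric_space \<times> 'b \<Rightarrow> 'a \<times> 'b"
  assumes "time_domain T"
    and "compact (UNIV :: 'a set)"
    and "compact (UNIV :: 'b set)"
    and "product_or_skew_product T \<psi> \<Theta>"
  shows "\<forall>\<xi>\<in>RC T \<Theta>. snd ` \<xi> \<subseteq> h_dual T \<psi> \<Theta> \<xi>"
proof
  fix \<xi> assume \<xi>: "\<xi> \<in> RC T \<Theta>"
  have XY: "compact (UNIV :: ('a \<times> 'b) set)"
    using compact_Times[OF assms(2,3)] by simp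
  have "snd ` \<xi> \<subseteq> A" if "\<xi> \<subseteq> iota_Y T \<Theta> A" for A
    using that by (fastforce simp: iota_Y_def Inv_def)
  moreover have "snd ` \<xi> \<subseteq> dual_repeller T \<psi> A"
    if A: "A \<in> Att T \<psi>" and "\<not> \<xi> \<subseteq> iota_Y T \<Theta> A" for A
  proof -
    have "\<xi> \<subseteq> dual_repeller T \<Theta> (iota_Y T \<Theta> A)"
      using RC_dichotomy[OF assms(1) XY dyn_sys_product_or_skew_product[OF assms(1,4)]
          iota_Y_in_Att[OF assms A] \<xi>] that(2) by blast
    then show ?thesis
      using snd_dual_repeller_iota_Y[OF assms A] by blast
  qed
  ultimately show "snd ` \<xi> \<subseteq> h_dual T \<psi> \<Theta> \<xi>"
    unfolding h_dual_def RC_of_ideal_def pulled_back_ideal_def by blast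
qed

end
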